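(* For all nonprincipal filters $\mathcal{F},\mathcal{G}$ on $\omega$, $\mathcal{F}\otimes\mathcal{G}$ is cofinally equivalent to $\mathcal{F}\otimes\mathcal{G}^{\otimes 2}$. In particular, $\mathcal{F}^{\otimes 2}$ is cofinally equivalent to $\mathcal{F}^{\otimes 3}$.
   Context: Filters on $\omega$ are ordered by containment $\supseteq$ (smaller sets are greater). Preorders $P$ and $Q$ are cofinally equivalent if there is a preorder $R$ such that $P$ and $Q$ are order isomorphic to cofinal subsets of $R$. Fix a pairing function (bijection) $\langle\cdot,\cdot\rangle$ from $\omega\times\omega$ to $\omega$; for $E\subseteq\omega$ and $i\in\omega$ let $(E)_i=\{j:\langle i,j\rangle\in E\}$. The Fubini product of filters $\mathcal{F},\mathcal{G}$ on $\omega$ is the filter $\mathcal{F}\otimes\mathcal{G}=\{E\subseteq\omega:\{i:(E)_i\in\mathcal{G}\}\in\mathcal{F}\}$ on $\omega$. Set $\mathcal{F}^{\otimes 1}=\mathcal{F}$ and $\mathcal{F}^{\otimes n+1}=\mathcal{F}\otimes\mathcal{F}^{\otimes n}$. *)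

theory Defs
  imports Main
begin

text \<open>
  Filters are those of the library. Its type \<^typ>\<open>'a filter\<close> includes the improper filter \<^term>\<open>bot\<close>,
  but that one equals \<^term>\<open>principal {}\<close>, so a nonprincipal filter is always proper.
  Nonprincipal is meant literally: not of the form \<open>{E. A \<subseteq> E}\<close>. Every proper filter
  containing all cofinite sets is nonprincipal in this sense.
\<close>

definition filter_sets :: "'a filter \<Rightarrow> 'a set set" where
  "filter_sets F = {E. eventually (\<lambda>x. x \<in> E) F}"

definition nonprincipal :: "'a filter \<Rightarrow> bool" where
  "nonprincipal F \<longleftrightarrow> (\<nexists>A. F = principal A)"

lemma nonprincipal_proper: "nonprincipal F \<Longrightarrow> F \<noteq> bot"
  unfolding nonprincipal_def by (metis bot_eq_principal_empty)

lemma filter_sets_principal: "filter_sets (principal A) = {E. A \<subseteq> E}"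
  by (auto simp: filter_sets_def eventually_principal)

lemma eventually_iff_filter_sets: "eventually P F \<longleftrightarrow> {x. P x} \<in> filter_sets F"
  by (simp add: filter_sets_def)


text \<open>
  The pairing function \<open>p\<close> is an explicit parameter, constrained to be a bijection where it is used.
\<close>

definition sect :: "(nat \<times> nat \<Rightarrow> nat) \<Rightarrow> nat set \<Rightarrow> nat \<Rightarrow> nat set" where
  "sect p E i = {j. p (i, j) \<in> E}"

definition fubini :: "(nat \<times> nat \<Rightarrow> nat) \<Rightarrow> nat filter \<Rightarrow> nat filter \<Rightarrow> nat filter" where
  "fubini p F G =
     Abs_filter (\<lambda>P. {i. sect p {n. P n} i \<in> filter_sets G} \<in> filter_sets F)"

lemma filter_sets_fubini:
  "filter_sets (fubini p F G) = {E. {i. sect p E i \<in> filter_sets G} \<in> filter_sets F}"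
proof -
  have "is_filter (\<lambda>P. {i. sect p {n. P n} i \<in> filter_sets G} \<in> filter_sets F)"
  proof (rule is_filter.intro, goal_cases)
    case 1
    show ?case by (simp add: filter_sets_def sect_def)
  next
    case (2 P Q)
    then show ?case
      by (auto simp: filter_sets_def sect_def eventually_conj_iff)
  next
    case (3 P Q)
    then show ?case
      by (auto simp: filter_sets_def sect_def elim!: eventually_mono)
  qed
  then have "eventually P (fubini p F G) \<longleftrightarrow>
      {i. sect p {n. P n} i \<in> filter_sets G} \<in> filter_sets F" for P
    unfolding fubini_def by (rule eventually_Abs_filter)
  then show ?thesis
    by (simp add: filter_sets_def[of "fubini p F G"])
qed

text \<open>Powers are only meaningful for exponents \<open>\<ge> 1\<close>; exponent \<open>0\<close> is left unspecified.\<close>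

fun fubini_power :: "(nat \<times> nat \<Rightarrow> nat) \<Rightarrow> nat filter \<Rightarrow> nat \<Rightarrow> nat filter" where
  "fubini_power p F (Suc 0) = F"
| "fubini_power p F (Suc (Suc n)) = fubini p F (fubini_power p F (Suc n))"


text \<open>
  A preorder is represented by its relation \<open>r\<close>, with carrier \<^term>\<open>Field r\<close>;
  \<^term>\<open>(x, y) \<in> r\<close> reads \<open>x \<le> y\<close>. (The library's \<^const>\<open>cofinal\<close> asks for strict bounds
  and therefore does not fit.)
\<close>

definition cofinal_subset :: "'a set \<Rightarrow> 'a rel \<Rightarrow> bool" where
  "cofinal_subset C r \<longleftrightarrow> C \<subseteq> Field r \<and> (\<forall>x\<in>Field r. \<exists>y\<in>C. (x, y) \<in> r)"

definition order_isomorphic :: "'a rel \<Rightarrow> 'b rel \<Rightarrow> bool" where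
  "order_isomorphic r s \<longleftrightarrow>
     (\<exists>f. bij_betw f (Field r) (Field s) \<and>
          (\<forall>x\<in>Field r. \<forall>y\<in>Field r. (x, y) \<in> r \<longleftrightarrow> (f x, f y) \<in> s))"

text \<open>
  HOL cannot quantify over the carrier type of the common preorder \<open>R\<close>. This loses nothing: a
  witness on any type yields one on the sum type, see \<open>cofinally_equivalentI\<close> below.
\<close>

definition cofinally_equivalent :: "'a rel \<Rightarrow> 'b rel \<Rightarrow> bool" where
  "cofinally_equivalent r s \<longleftrightarrow>
     (\<exists>R :: ('a + 'b) rel. preorder_on (Field R) R \<and>
        (\<exists>C. cofinal_subset C R \<and> order_isomorphic r (Restr R C)) \<and>
        (\<exists>D. cofinal_subset D R \<and> order_isomorphic s (Restr R D)))"

lemma Field_Restr_preorder: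
  assumes "preorder_on (Field R) R" "C \<subseteq> Field R"
  shows "Field (Restr R C) = C"
  using assms by (auto simp: preorder_on_def refl_on_def Field_def)

lemma cofinally_equivalentI:
  fixes r :: "'a rel" and s :: "'b rel" and R :: "'c rel"
  assumes R: "preorder_on (Field R) R"
    and C: "cofinal_subset C R" "order_isomorphic r (Restr R C)"
    and D: "cofinal_subset D R" "order_isomorphic s (Restr R D)"
  shows "cofinally_equivalent r s"
proof -
  have fC: "Field (Restr R C) = C" and fD: "Field (Restr R D) = D"
    using Field_Restr_preorder[OF R] C(1) D(1) by (auto simp: cofinal_subset_def)
  obtain f where f: "bij_betw f (Field r) C"
      "\<And>x y. x \<in> Field r \<Longrightarrow> y \<in> Field r \<Longrightarrow> (x, y) \<in> r \<longleftrightarrow> (f x, f y) \<in> Restr R C"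
    using C(2) unfolding order_isomorphic_def fC by blast
  obtain g where g: "bij_betw g (Field s) D"
      "\<And>x y. x \<in> Field s \<Longrightarrow> y \<in> Field s \<Longrightarrow> (x, y) \<in> s \<longleftrightarrow> (g x, g y) \<in> Restr R D"
    using D(2) unfolding order_isomorphic_def fD by blast
  have fi: "f ` Field r = C" and gi: "g ` Field s = D"
    using f(1) g(1) by (auto simp: bij_betw_def)
  define h where "h = case_sum f g"
  define K where "K = Inl ` Field r \<union> Inr ` Field s"
  define S where "S = {(u, v). u \<in> K \<and> v \<in> K \<and> (h u, h v) \<in> R}"
  have hK: "h u \<in> Field R" if "u \<in> K" for u
    using that fi gi C(1) D(1) by (auto simp: K_def h_def cofinal_subset_def)
  have reflR: "(x, x) \<in> R" if "x \<in> Field R" for x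
    using R that by (auto simp: preorder_on_def refl_on_def)
  have FS: "Field S = K"
    using hK reflR by (auto simp: S_def Field_def)
  have "trans R" using R by (simp add: preorder_on_def)
  then have pS: "preorder_on (Field S) S"
    unfolding FS using hK reflR
    by (auto simp: preorder_on_def refl_on_def S_def trans_def)
  have cC: "cofinal_subset (Inl ` Field r) S"
    unfolding cofinal_subset_def FS
  proof (intro conjI ballI)
    show "Inl ` Field r \<subseteq> K" by (auto simp: K_def)
    fix u assume u: "u \<in> K"
    then obtain c where "c \<in> C" "(h u, c) \<in> R"
      using hK[OF u] C(1) by (auto simp: cofinal_subset_def)
    then obtain x where "x \<in> Field r" "(h u, f x) \<in> R" using fi by auto
    then show "\<exists>v\<in>Inl ` Field r. (u, v) \<in> S"
      using u by (auto simp: S_def K_def h_def)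
  qed
  have cD: "cofinal_subset (Inr ` Field s) S"
    unfolding cofinal_subset_def FS
  proof (intro conjI ballI)
    show "Inr ` Field s \<subseteq> K" by (auto simp: K_def)
    fix u assume u: "u \<in> K"
    then obtain c where "c \<in> D" "(h u, c) \<in> R"
      using hK[OF u] D(1) by (auto simp: cofinal_subset_def)
    then obtain x where "x \<in> Field s" "(h u, g x) \<in> R" using gi by auto
    then show "\<exists>v\<in>Inr ` Field s. (u, v) \<in> S"
      using u by (auto simp: S_def K_def h_def)
  qed
  have iC: "order_isomorphic r (Restr S (Inl ` Field r))"
    unfolding order_isomorphic_def
  proof (intro exI[of _ Inl] conjI ballI)
    show "bij_betw Inl (Field r) (Field (Restr S (Inl ` Field r)))"
      using Field_Restr_preorder[OF pS] cC by (auto simp: cofinal_subset_def bij_betw_def)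
    fix x y assume xy: "x \<in> Field r" "y \<in> Field r"
    then show "(x, y) \<in> r \<longleftrightarrow> (Inl x, Inl y) \<in> Restr S (Inl ` Field r)"
      using f(2)[OF xy] fi by (auto simp: S_def K_def h_def)
  qed
  have iD: "order_isomorphic s (Restr S (Inr ` Field s))"
    unfolding order_isomorphic_def
  proof (intro exI[of _ Inr] conjI ballI)
    show "bij_betw Inr (Field s) (Field (Restr S (Inr ` Field s)))"
      using Field_Restr_preorder[OF pS] cD by (auto simp: cofinal_subset_def bij_betw_def)
    fix x y assume xy: "x \<in> Field s" "y \<in> Field s"
    then show "(x, y) \<in> s \<longleftrightarrow> (Inr x, Inr y) \<in> Restr S (Inr ` Field s)"
      using g(2)[OF xy] gi by (auto simp: S_def K_def h_def)
  qed
  show ?thesis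
    unfolding cofinally_equivalent_def using pS cC cD iC iD by blast
qed


text \<open>A filter as a preorder: smaller sets are greater.\<close>

definition filter_order :: "'a filter \<Rightarrow> 'a set rel" where
  "filter_order F = {(A, B). A \<in> filter_sets F \<and> B \<in> filter_sets F \<and> A \<supseteq> B}"

lemma Field_filter_order: "Field (filter_order F) = filter_sets F"
  by (auto simp: filter_order_def Field_def)

lemma preorder_filter_order: "preorder_on (filter_sets F) (filter_order F)"
  by (auto simp: preorder_on_def refl_on_def trans_def filter_order_def)

end

theory Submission
  imports Defs
begin

text \<open>
  The proof compares the two filters by Tukey reductions. Between directed preorders, reductions in
  both directions produce a common cofinal extension (\<open>cofinally_equivalent_if_tukey_le\<close>), so it
  suffices to reduce each filter to the other.

  Projecting away the middle coordinate reduces \<open>\<F> \<otimes> \<G>\<close> to \<open>\<F> \<otimes> \<G>\<^sup>\<otimes>\<^sup>2\<close>.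

  For the opposite reduction (\<open>tukey_le_fubini_square\<close>), a member \<open>D\<close> of \<open>\<F> \<otimes> \<G>\<^sup>\<otimes>\<^sup>2\<close> is described
  by a set \<open>A \<in> \<F>\<close> together with countably many members of \<open>\<G>\<close>: for \<open>i \<in> A\<close> the set \<open>A\<^sub>i\<close> of
  those \<open>j\<close> for which the section \<open>D\<^sub>i\<^sub>j\<close> is in \<open>\<G>\<close>, and these sections themselves. At stage \<open>i \<in> A\<close>
  only finitely many of them have indices up to \<open>i\<close>, so \<open>\<G>\<close> contains their intersection \<open>B\<^sub>i\<close>, and
  the \<open>B\<^sub>i\<close> with \<open>i \<in> A\<close> form a member of \<open>\<F> \<otimes> \<G>\<close>. If \<open>E \<in> \<F> \<otimes> \<G>\<close> lies inside it, then \<open>E\<close>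
  determines a member of \<open>\<F> \<otimes> \<G>\<^sup>\<otimes>\<^sup>2\<close> inside \<open>D\<close>: a set in \<open>\<G>\<close> contained in \<open>D\<^sub>i\<^sub>j\<close> is found among
  the sections of \<open>E\<close> at any large enough stage. Such stages exist because all members of a
  nonprincipal filter on \<open>\<omega>\<close> are infinite (\<open>infinite_if_nonprincipal\<close>).
\<close>

section \<open>Tukey reductions and cofinal equivalence\<close>

text \<open>
  A Tukey reduction in the form of a Galois--Tukey connection. The existence of the second map says
  that the first sends unbounded sets to unbounded sets.
\<close>

definition tukey_le :: "'a rel \<Rightarrow> 'b rel \<Rightarrow> bool" where
  "tukey_le r s \<longleftrightarrow>
     (\<exists>f g. (\<forall>x\<in>Field r. f x \<in> Field s) \<and> (\<forall>y\<in>Field s. g y \<in> Field r) \<and>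
            (\<forall>x\<in>Field r. \<forall>y\<in>Field s. (f x, y) \<in> s \<longrightarrow> (x, g y) \<in> r))"

definition directed :: "'a rel \<Rightarrow> bool" where
  "directed r \<longleftrightarrow> (\<forall>x\<in>Field r. \<forall>y\<in>Field r. \<exists>z\<in>Field r. (x, z) \<in> r \<and> (y, z) \<in> r)"

text \<open>
  Let \<open>(f, f')\<close> reduce \<open>r\<close> to \<open>s\<close> and \<open>(g, g')\<close> reduce \<open>s\<close> to \<open>r\<close>. On the disjoint union, \<open>x\<close> is
  put below \<open>y\<close> if \<open>y\<close> bounds both \<open>f x'\<close> and \<open>g' x'\<close> for some \<open>x' \<ge> x\<close>, and symmetrically. The
  first bound makes passing from \<open>r\<close> to \<open>s\<close> and back increasing, the second does so for passing from
  \<open>s\<close> to \<open>r\<close> and back; hence the order on each half remains the given one. Directedness provides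
  common bounds, so each half is cofinal.
\<close>

lemma cofinally_equivalent_if_tukey_le:
  fixes r :: "'a rel" and s :: "'b rel"
  assumes r: "preorder_on (Field r) r" "directed r"
    and s: "preorder_on (Field s) s" "directed s"
    and rs: "tukey_le r s" and sr: "tukey_le s r"
  shows "cofinally_equivalent r s"
proof -
  from rs obtain f f' where f: "\<And>x. x \<in> Field r \<Longrightarrow> f x \<in> Field s"
      "\<And>y. y \<in> Field s \<Longrightarrow> f' y \<in> Field r"
      "\<And>x y. x \<in> Field r \<Longrightarrow> y \<in> Field s \<Longrightarrow> (f x, y) \<in> s \<Longrightarrow> (x, f' y) \<in> r"
    unfolding tukey_le_def by blast
  from sr obtain g g' where g: "\<And>y. y \<in> Field s \<Longrightarrow> g y \<in> Field r"
      "\<And>x. x \<in> Field r \<Longrightarrow> g' x \<in> Field s"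
      "\<And>x y. x \<in> Field r \<Longrightarrow> y \<in> Field s \<Longrightarrow> (g y, x) \<in> r \<Longrightarrow> (y, g' x) \<in> s"
    unfolding tukey_le_def by blast
  have refl: "\<And>x. x \<in> Field r \<Longrightarrow> (x, x) \<in> r" "\<And>y. y \<in> Field s \<Longrightarrow> (y, y) \<in> s"
    using r s by (auto simp: preorder_on_def refl_on_def)
  have tr: "\<And>x y z. (x, y) \<in> r \<Longrightarrow> (y, z) \<in> r \<Longrightarrow> (x, z) \<in> r"
    using r by (auto simp: preorder_on_def dest: transD)
  have ts: "\<And>x y z. (x, y) \<in> s \<Longrightarrow> (y, z) \<in> s \<Longrightarrow> (x, z) \<in> s"
    using s by (auto simp: preorder_on_def dest: transD)
  define L where "L x y \<longleftrightarrow> (\<exists>x'. (x, x') \<in> r \<and> (f x', y) \<in> s \<and> (g' x', y) \<in> s)" for x y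
  define M where "M y x \<longleftrightarrow> (\<exists>y'. (y, y') \<in> s \<and> (g y', x) \<in> r \<and> (f' y', x) \<in> r)" for y x
  have r_via_s: "(x, z) \<in> r" if L: "L x y" and M: "M y z" for x y z
  proof -
    from L obtain x' where x': "(x, x') \<in> r" "(f x', y) \<in> s" unfolding L_def by blast
    from M obtain y' where y': "(y, y') \<in> s" "(f' y', z) \<in> r" unfolding M_def by blast
    have "(x', f' y') \<in> r"
      using x' y' by (intro f(3) ts[OF x'(2) y'(1)]) (auto intro: FieldI1 FieldI2)
    then show ?thesis using tr x'(1) y'(2) by blast
  qed
  have s_via_r: "(y, z) \<in> s" if M: "M y x" and L: "L x z" for y x z
  proof -
    from L obtain x' where x': "(x, x') \<in> r" "(g' x', z) \<in> s" unfolding L_def by blast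
    from M obtain y' where y': "(y, y') \<in> s" "(g y', x) \<in> r" unfolding M_def by blast
    have "(y', g' x') \<in> s"
      using x' y' by (intro g(3) tr[OF y'(2) x'(1)]) (auto intro: FieldI1 FieldI2)
    then show ?thesis using ts y'(1) x'(2) by blast
  qed
  have rL: "L x z" if "(x, y) \<in> r" "L y z" for x y z
    using that tr unfolding L_def by blast
  have Ls: "L x z" if "L x y" "(y, z) \<in> s" for x y z
    using that ts unfolding L_def by blast
  have sM: "M x z" if "(x, y) \<in> s" "M y z" for x y z
    using that ts unfolding M_def by blast
  have Mr: "M x z" if "M x y" "(y, z) \<in> r" for x y z
    using that tr unfolding M_def by blast
  have exL: "\<exists>y\<in>Field s. L x y" if "x \<in> Field r" for x
    using s(2) f(1)[OF that] g(2)[OF that] refl(1)[OF that]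
    unfolding directed_def L_def by blast
  have exM: "\<exists>x\<in>Field r. M y x" if "y \<in> Field s" for y
    using r(2) g(1)[OF that] f(2)[OF that] refl(2)[OF that]
    unfolding directed_def M_def by blast
  have LF: "x \<in> Field r" "y \<in> Field s" if "L x y" for x y
    using that unfolding L_def by (auto intro: FieldI1 FieldI2)
  have MF: "x \<in> Field r" "y \<in> Field s" if "M y x" for x y
    using that unfolding M_def by (auto intro: FieldI1 FieldI2)
  define R :: "('a + 'b) rel" where
    "R = {(u, v). case u of
            Inl x \<Rightarrow> (case v of Inl x' \<Rightarrow> (x, x') \<in> r | Inr y' \<Rightarrow> L x y')
          | Inr y \<Rightarrow> (case v of Inl x' \<Rightarrow> M y x' | Inr y' \<Rightarrow> (y, y') \<in> s)}"
  have R: "(Inl x, Inl x') \<in> R \<longleftrightarrow> (x, x') \<in> r" "(Inl x, Inr y') \<in> R \<longleftrightarrow> L x y'"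
      "(Inr y, Inl x') \<in> R \<longleftrightarrow> M y x'" "(Inr y, Inr y') \<in> R \<longleftrightarrow> (y, y') \<in> s" for x x' y y'
    by (simp_all add: R_def)
  have mem: "u \<in> Inl ` Field r \<union> Inr ` Field s" "v \<in> Inl ` Field r \<union> Inr ` Field s"
    if "(u, v) \<in> R" for u v
    using that LF MF
    by (cases u; cases v; auto simp: R intro: FieldI1 FieldI2)+
  have reflR: "(u, u) \<in> R" if "u \<in> Inl ` Field r \<union> Inr ` Field s" for u
    using that refl by (auto simp: R)
  have FR: "Field R = Inl ` Field r \<union> Inr ` Field s"
  proof
    show "Field R \<subseteq> Inl ` Field r \<union> Inr ` Field s" using mem by (fastforce simp: Field_def)
    show "Inl ` Field r \<union> Inr ` Field s \<subseteq> Field R" using reflR by (meson FieldI1 subsetI)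
  qed
  have "trans R"
  proof (rule transI)
    fix u v w assume "(u, v) \<in> R" "(v, w) \<in> R"
    then show "(u, w) \<in> R"
      by (cases u; cases v; cases w; simp add: R)
        (erule (1) tr ts rL Ls sM Mr r_via_s s_via_r)+
  qed
  then have pR: "preorder_on (Field R) R"
    using mem reflR unfolding FR preorder_on_def refl_on_def by fast
  have C: "cofinal_subset (Inl ` Field r) R" and D: "cofinal_subset (Inr ` Field s) R"
    unfolding cofinal_subset_def FR using refl exL exM by (simp_all add: R ball_Un) blast+
  have "order_isomorphic r (Restr R (Inl ` Field r))"
    unfolding order_isomorphic_def using Field_Restr_preorder[OF pR, of "Inl ` Field r"] FR
    by (intro exI[of _ Inl]) (auto simp: bij_betw_def R)
  moreover have "order_isomorphic s (Restr R (Inr ` Field s))"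
    unfolding order_isomorphic_def using Field_Restr_preorder[OF pR, of "Inr ` Field s"] FR
    by (intro exI[of _ Inr]) (auto simp: bij_betw_def R)
  ultimately show ?thesis
    unfolding cofinally_equivalent_def using pR C D by blast
qed

section \<open>Filters, sections and Fubini products\<close>

lemma filter_sets_Int: "A \<in> filter_sets F \<Longrightarrow> B \<in> filter_sets F \<Longrightarrow> A \<inter> B \<in> filter_sets F"
  by (simp add: filter_sets_def eventually_conj)

lemma filter_sets_mono: "A \<in> filter_sets F \<Longrightarrow> A \<subseteq> B \<Longrightarrow> B \<in> filter_sets F"
  by (auto simp: filter_sets_def elim: eventually_mono)

lemma directed_filter_order: "directed (filter_order F)"
  unfolding directed_def Field_filter_order
proof (intro ballI)
  fix A B assume "A \<in> filter_sets F" "B \<in> filter_sets F"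
  then show "\<exists>C\<in>filter_sets F. (A, C) \<in> filter_order F \<and> (B, C) \<in> filter_order F"
    by (intro bexI[of _ "A \<inter> B"]) (auto simp: filter_order_def filter_sets_Int)
qed

lemma filter_sets_nonempty: "F \<noteq> bot \<Longrightarrow> A \<in> filter_sets F \<Longrightarrow> A \<noteq> {}"
  by (auto simp: filter_sets_def)

text \<open>A finite member that is minimal under inclusion would generate the filter.\<close>

lemma infinite_if_nonprincipal:
  assumes "nonprincipal F" and "A \<in> filter_sets F"
  shows "infinite A"
proof
  assume "finite A"
  then show False using assms(2)
  proof (induction rule: finite_psubset_induct)
    case (psubset A)
    have "\<not> A \<inter> E \<subset> A" if "E \<in> filter_sets F" for E
      using psubset.IH[of "A \<inter> E"] filter_sets_Int[OF psubset.prems that] by blast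
    then have "E \<in> filter_sets F \<longleftrightarrow> A \<subseteq> E" for E
      using filter_sets_mono[OF psubset.prems] by blast
    then have "F = principal A"
      unfolding filter_eq_iff eventually_principal by (auto simp: eventually_iff_filter_sets[of _ F])
    then show False using assms(1) by (auto simp: nonprincipal_def)
  qed
qed

lemma sect_image_Sigma:
  assumes "inj p"
  shows "sect p (p ` Sigma A B) i = (if i \<in> A then B i else {})"
  using assms by (auto simp: sect_def inj_image_mem_iff)

lemma subset_if_sect_subset:
  assumes "surj p" and "\<And>i. sect p D i \<subseteq> sect p E i"
  shows "D \<subseteq> E"
proof
  fix n assume "n \<in> D"
  moreover obtain i j where "n = p (i, j)" using assms(1) by (metis surjD surj_pair)
  ultimately show "n \<in> E" using assms(2)[of i] by (auto simp: sect_def)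
qed

lemma sect_empty: "sect p {} i = {}"
  by (simp add: sect_def)

lemma sect_mono: "D \<subseteq> E \<Longrightarrow> sect p D i \<subseteq> sect p E i"
  by (auto simp: sect_def)

lemma image_Sigma_in_fubini:
  assumes "inj p" and "A \<in> filter_sets F" and "\<And>i. i \<in> A \<Longrightarrow> B i \<in> filter_sets G"
  shows "p ` Sigma A B \<in> filter_sets (fubini p F G)"
  using assms by (auto simp: filter_sets_fubini sect_image_Sigma intro: filter_sets_mono[of A])

lemma tukey_le_filter_orderI:
  assumes "\<And>D. D \<in> filter_sets F \<Longrightarrow> f D \<in> filter_sets G"
    and "\<And>E. E \<in> filter_sets G \<Longrightarrow> g E \<in> filter_sets F"
    and "\<And>D E. D \<in> filter_sets F \<Longrightarrow> E \<in> filter_sets G \<Longrightarrow> E \<subseteq> f D \<Longrightarrow> g E \<subseteq> D"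
  shows "tukey_le (filter_order F) (filter_order G)"
  unfolding tukey_le_def Field_filter_order using assms
  by (intro exI[of _ f] exI[of _ g]) (auto simp: filter_order_def)

section \<open>Reductions between Fubini products\<close>

text \<open>
  Sections are repeated along the middle coordinate. Since \<open>\<G>\<close> is proper, every member of
  \<open>\<G> \<otimes> \<G>\<close> has a section in \<open>\<G>\<close>; hence the union of its sections is in \<open>\<G>\<close>, which yields the map back.
\<close>

lemma tukey_le_fubini_insert_middle:
  assumes p: "bij p" and G: "G \<noteq> bot"
  shows "tukey_le (filter_order (fubini p F G)) (filter_order (fubini p F (fubini p G G)))"
proof -
  have inj: "inj p" and surj: "surj p" using p by (auto simp: bij_def)
  let ?G2 = "fubini p G G"
  have UNIV: "UNIV \<in> filter_sets F" for F :: "nat filter" by (simp add: filter_sets_def)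
  have cyl: "p ` (UNIV \<times> B) \<in> filter_sets ?G2" if "B \<in> filter_sets G" for B
    using that by (intro image_Sigma_in_fubini inj UNIV)
  have proj: "(\<Union>j. sect p K j) \<in> filter_sets G" if "K \<in> filter_sets ?G2" for K
  proof -
    have "{j. sect p K j \<in> filter_sets G} \<noteq> {}"
      using that by (intro filter_sets_nonempty[OF G]) (simp add: filter_sets_fubini)
    then show ?thesis by (auto intro: filter_sets_mono)
  qed
  show ?thesis
  proof (rule tukey_le_filter_orderI)
    fix D assume "D \<in> filter_sets (fubini p F G)"
    then show "p ` Sigma {i. sect p D i \<in> filter_sets G} (\<lambda>i. p ` (UNIV \<times> sect p D i))
        \<in> filter_sets (fubini p F ?G2)"
      by (intro image_Sigma_in_fubini[OF inj, where F = F]) (simp_all add: filter_sets_fubini[of p F G] cyl)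
  next
    fix E assume "E \<in> filter_sets (fubini p F ?G2)"
    then show "p ` Sigma {i. sect p E i \<in> filter_sets ?G2} (\<lambda>i. \<Union>j. sect p (sect p E i) j)
        \<in> filter_sets (fubini p F G)"
      by (intro image_Sigma_in_fubini[OF inj, where F = F]) (simp_all add: filter_sets_fubini[of p F ?G2] proj)
  next
    fix D E
    assume sub: "E \<subseteq> p ` Sigma {i. sect p D i \<in> filter_sets G} (\<lambda>i. p ` (UNIV \<times> sect p D i))"
    have sub2: "sect p (sect p E i) j \<subseteq> sect p D i" for i j
      using sect_mono[OF sect_mono[OF sub, of p i], of p j]
      by (auto simp: sect_image_Sigma[OF inj] sect_empty split: if_splits)
    show "p ` Sigma {i. sect p E i \<in> filter_sets ?G2} (\<lambda>i. \<Union>j. sect p (sect p E i) j) \<subseteq> D"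
      by (rule subset_if_sect_subset[OF surj]) (simp add: sect_image_Sigma[OF inj] UN_least sub2)
  qed
qed

text \<open>
  The diagonal reduction: stage \<open>m\<close> of the image of \<open>D\<close> lies below all the data of \<open>D\<close> with
  indices up to \<open>m\<close>. The members of \<open>\<F>\<close> are unbounded, so every datum is covered by some stage at
  which \<open>E\<close> has a section in \<open>\<G>\<close>.
\<close>

lemma tukey_le_fubini_square:
  assumes p: "bij p" and F: "\<And>A. A \<in> filter_sets F \<Longrightarrow> infinite A" and G: "G \<noteq> bot"
  shows "tukey_le (filter_order (fubini p F (fubini p G G))) (filter_order (fubini p F G))"
proof -
  have inj: "inj p" and surj: "surj p" using p by (auto simp: bij_def)
  let ?G2 = "fubini p G G"
  have fin: "(\<Inter>i\<in>I. X i) \<in> filter_sets G" if "finite I" "\<And>i. i \<in> I \<Longrightarrow> X i \<in> filter_sets G"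
    for I :: "nat set" and X
    using that by (auto simp: filter_sets_def eventually_ball_finite_distrib)
  define A where "A D = {i. sect p D i \<in> filter_sets ?G2}" for D
  define J where "J D i = {j. sect p (sect p D i) j \<in> filter_sets G}" for D i
  define B where "B D m = (\<Inter>i\<in>A D \<inter> {..m}. J D i \<inter> (\<Inter>j\<in>J D i \<inter> {..m}. sect p (sect p D i) j))"
    for D m
  have J: "J D i \<in> filter_sets G" if "i \<in> A D" for D i
    using that by (simp add: A_def J_def filter_sets_fubini)
  have B: "B D m \<in> filter_sets G" for D m
    unfolding B_def by (intro fin filter_sets_Int) (auto simp: J, simp add: J_def)
  define S where "S E = {i. sect p E i \<in> filter_sets G}" for E
  define stage where "stage E i j = (SOME m. m \<in> S E \<and> i \<le> m \<and> j \<le> m)" for E i j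
  have S: "S E \<in> filter_sets F" if "E \<in> filter_sets (fubini p F G)" for E
    using that by (simp add: S_def filter_sets_fubini)
  have stage: "stage E i j \<in> S E \<and> i \<le> stage E i j \<and> j \<le> stage E i j"
    if "E \<in> filter_sets (fubini p F G)" for E i j
  proof -
    have "infinite (S E)" using F[OF S[OF that]] .
    then obtain m where "m \<in> S E" "max i j \<le> m"
      by (meson finite_nat_set_iff_bounded not_le)
    then have "m \<in> S E \<and> i \<le> m \<and> j \<le> m" by simp
    then show ?thesis unfolding stage_def by (rule someI)
  qed
  show ?thesis
  proof (rule tukey_le_filter_orderI)
    fix D assume "D \<in> filter_sets (fubini p F ?G2)"
    then show "p ` Sigma (A D) (B D) \<in> filter_sets (fubini p F G)"
      by (intro image_Sigma_in_fubini inj B) (simp add: A_def filter_sets_fubini[of p F ?G2])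
  next
    fix E assume E: "E \<in> filter_sets (fubini p F G)"
    show "p ` Sigma (S E) (\<lambda>i. p ` Sigma (sect p E i) (\<lambda>j. sect p E (stage E i j)))
        \<in> filter_sets (fubini p F ?G2)"
    proof (intro image_Sigma_in_fubini inj S E)
      fix i j
      show "sect p E i \<in> filter_sets G" if "i \<in> S E" using that by (simp add: S_def)
      show "sect p E (stage E i j) \<in> filter_sets G" using stage[OF E] by (auto simp: S_def)
    qed
  next
    fix D E
    assume E: "E \<in> filter_sets (fubini p F G)" and sub: "E \<subseteq> p ` Sigma (A D) (B D)"
    \<comment> \<open>A section in \<open>G\<close> is nonempty, so it can only occur at an index in \<open>A D\<close>.\<close>
    have AB: "m \<in> A D \<and> sect p E m \<subseteq> B D m" if "m \<in> S E" for m
      using that sect_mono[OF sub, of p m] filter_sets_nonempty[OF G, of "sect p E m"]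
      by (auto simp: S_def sect_image_Sigma[OF inj] split: if_splits)
    have sub2: "sect p E (stage E i j) \<subseteq> sect p (sect p D i) j" if "i \<in> S E" "j \<in> sect p E i" for i j
    proof -
      have i: "i \<in> A D" and "j \<in> B D i" using AB[OF that(1)] that(2) by auto
      then have "j \<in> J D i" by (auto simp: B_def)
      then have "B D (stage E i j) \<subseteq> sect p (sect p D i) j"
        using i stage[OF E, of i j] by (auto simp: B_def)
      then show ?thesis using AB stage[OF E, of i j] by blast
    qed
    show "p ` Sigma (S E) (\<lambda>i. p ` Sigma (sect p E i) (\<lambda>j. sect p E (stage E i j))) \<subseteq> D"
      (is "?E2 \<subseteq> D")
    proof (rule subset_if_sect_subset[OF surj], rule subset_if_sect_subset[OF surj])
      show "sect p (sect p ?E2 i) j \<subseteq> sect p (sect p D i) j" for i j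
        using sub2[of i j] by (simp add: sect_image_Sigma[OF inj] sect_empty)
    qed
  qed
qed

theorem theorem5p2:
  fixes p :: "nat \<times> nat \<Rightarrow> nat" and F G :: "nat filter"
  assumes "bij p" and "nonprincipal F" and "nonprincipal G"
  shows "cofinally_equivalent
           (filter_order (fubini p F G))
           (filter_order (fubini p F (fubini_power p G 2)))
       \<and> cofinally_equivalent
           (filter_order (fubini_power p F 2))
           (filter_order (fubini_power p F 3))"
proof -
  have *: "cofinally_equivalent (filter_order (fubini p F H))
      (filter_order (fubini p F (fubini p H H)))" if "nonprincipal H" for H
    using nonprincipal_proper[OF that]
    by (intro cofinally_equivalent_if_tukey_le directed_filter_order
        tukey_le_fubini_insert_middle tukey_le_fubini_square
        infinite_if_nonprincipal[OF assms(2)] assms(1))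
      (simp_all add: Field_filter_order preorder_filter_order)
  show ?thesis
    using *[OF assms(2)] *[OF assms(3)] by (simp add: numeral_2_eq_2 numeral_3_eq_3)
qed

end
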